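(* Let $f:\mathbb{R}^n\to\mathbb{R}^n$ be a function, $F:\mathbb{R}^n\rightrightarrows\mathbb{R}^n$ a set-valued map with closed graph, and $p:[0,1]\to\mathbb{R}^n$ a function. For $t\in[0,1]$ put $G_t(v)=f(v)-p(t)+F(v)$ and $S(t)=\{z\in\mathbb{R}^n : 0\in G_t(z)\}$. Assume that (i) $z:[0,1]\to\mathbb{R}^n$ is a given solution trajectory (that is, $z(t)\in S(t)$ for all $t\in[0,1]$) which is isolated from other trajectories, meaning that there is an open set $\mathcal{O}\subset\mathbb{R}^{n+1}$ such that $$\{(t,v) : t\in[0,1]\text{ and }0\in G_t(v)\}\cap\mathcal{O}=\mathrm{gph}\,z;$$ (ii) $p$ is continuous; (iii) $G_t$ is pointwise strongly metrically regular, i.e. for every $t\in[0,1]$, $G_t$ is strongly metrically regular at $z(t)$ for $0$, with constants $a_t,b_t,\kappa_t>0$. Then $z(\cdot)$ is a continuous function.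
   Context: $\mathbb{B}_r(x)$ denotes the closed Euclidean ball of radius $r$ around $x$. For a function $z:[0,1]\to\mathbb{R}^n$, $\mathrm{gph}\,z=\{(t,z(t)) : t\in[0,1]\}$. $G_t$ is strongly metrically regular at $z(t)$ for $0$ with constants $a_t,b_t,\kappa_t>0$ if $0\in G_t(z(t))$ and the mapping $\mathbb{B}_{b_t}(0)\ni y\mapsto G_t^{-1}(y)\cap\mathbb{B}_{a_t}(z(t))$ is single-valued (exactly one element for each $y$) and Lipschitz continuous with Lipschitz constant $\kappa_t$. *)

theory Defs
  imports "HOL-Analysis.Analysis"
begin

text \<open>
  A set-valued map is a function into sets; its value may be empty, so its effective domain need
  not be the whole type. A function on $[0,1]$ is a total function on the reals of which only the
  restriction to \<^term>\<open>{0..1::real}\<close> is used.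
\<close>

definition graph :: "('a \<Rightarrow> 'b set) \<Rightarrow> ('a \<times> 'b) set" where
  "graph H = {(x, y). y \<in> H x}"

definition setvalued_inverse :: "('a \<Rightarrow> 'b set) \<Rightarrow> 'b \<Rightarrow> 'a set" where
  "setvalued_inverse H y = {x. y \<in> H x}"

definition gph01 :: "(real \<Rightarrow> 'a) \<Rightarrow> (real \<times> 'a) set" where
  "gph01 z = {(t, z t) | t. t \<in> {0..1}}"

text \<open>
  The description operator in the Lipschitz condition denotes the single-valued localization; it
  is well defined because of the preceding uniqueness condition.
\<close>

definition strongly_metrically_regular ::
    "('a::metric_space \<Rightarrow> 'b::metric_space set) \<Rightarrow> 'a \<Rightarrow> 'b \<Rightarrow> real \<Rightarrow> real \<Rightarrow> real \<Rightarrow> bool" where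
  "strongly_metrically_regular H xbar ybar a b \<kappa> \<longleftrightarrow>
     a > 0 \<and> b > 0 \<and> \<kappa> > 0 \<and> ybar \<in> H xbar \<and>
     (\<forall>y \<in> cball ybar b. \<exists>!x. x \<in> setvalued_inverse H y \<inter> cball xbar a) \<and>
     \<kappa>-lipschitz_on (cball ybar b) (\<lambda>y. THE x. x \<in> setvalued_inverse H y \<inter> cball xbar a)"

definition G_map ::
    "('a::real_vector \<Rightarrow> 'a) \<Rightarrow> ('a \<Rightarrow> 'a set) \<Rightarrow> (real \<Rightarrow> 'a) \<Rightarrow> real \<Rightarrow> 'a \<Rightarrow> 'a set" where
  "G_map f F p t v = {f v - p t + w | w. w \<in> F v}"

definition solution_set ::
    "('a::real_vector \<Rightarrow> 'a) \<Rightarrow> ('a \<Rightarrow> 'a set) \<Rightarrow> (real \<Rightarrow> 'a) \<Rightarrow> real \<Rightarrow> 'a set" where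
  "solution_set f F p t = {v. 0 \<in> G_map f F p t v}"

end

theory Submission
  imports Defs
begin

text \<open>
  A time shift from \<open>t\<close> to \<open>s\<close> is a perturbation of the right-hand side: \<open>0 \<in> G\<^sub>s(x)\<close> iff
  \<open>p(s) - p(t) \<in> G\<^sub>t(x)\<close>. Regularity at \<open>t\<close> thus yields, for \<open>s\<close> near \<open>t\<close>, a solution at time \<open>s\<close>
  within distance \<open>\<kappa>\<^sub>t \<parallel>p(s) - p(t)\<parallel>\<close> of \<open>z(t)\<close>. It lies in the isolating open set, so it is \<open>z(s)\<close>.
\<close>

lemma G_map_time_shift: "0 \<in> G_map f F p s x \<longleftrightarrow> p s - p t \<in> G_map f F p t x"
proof -
  have "0 = f x - p s + w \<longleftrightarrow> p s - p t = f x - p t + w" for w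
    by (auto simp: algebra_simps)
  then show ?thesis
    unfolding G_map_def by simp
qed

text \<open>By uniqueness the single-valued localization takes the value \<open>xbar\<close> at
  \<open>ybar\<close>, so its Lipschitz estimate between \<open>y\<close> and \<open>ybar\<close>
  becomes a bound on the distance to \<open>xbar\<close>.\<close>

lemma strongly_metrically_regular_solution:
  assumes "strongly_metrically_regular H xbar ybar a b \<kappa>" and "y \<in> cball ybar b"
  obtains x where "y \<in> H x" and "dist x xbar \<le> \<kappa> * dist y ybar"
proof -
  let ?P = "\<lambda>y x. x \<in> setvalued_inverse H y \<inter> cball xbar a"
  let ?\<sigma> = "\<lambda>y. THE x. ?P y x"
  have pos: "a > 0" "b > 0" and base: "ybar \<in> H xbar"
    and ex1: "\<And>y. y \<in> cball ybar b \<Longrightarrow> \<exists>!x. ?P y x"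
    and lip: "\<kappa>-lipschitz_on (cball ybar b) ?\<sigma>"
    using assms(1) unfolding strongly_metrically_regular_def by blast+
  have centre: "ybar \<in> cball ybar b"
    using pos by simp
  have "?P ybar xbar"
    using base pos by (simp add: setvalued_inverse_def)
  then have "?\<sigma> ybar = xbar"
    by (rule the1_equality[OF ex1[OF centre]])
  moreover have "dist (?\<sigma> y) (?\<sigma> ybar) \<le> \<kappa> * dist y ybar"
    by (rule lipschitz_onD[OF lip assms(2) centre])
  moreover have "?P y (?\<sigma> y)"
    by (rule theI'[OF ex1[OF assms(2)]])
  ultimately show thesis
    by (intro that[of "?\<sigma> y"]) (simp_all add: setvalued_inverse_def)
qed

theorem proposition4p4:
  fixes f :: "real ^ 'n \<Rightarrow> real ^ 'n"
    and F :: "real ^ 'n \<Rightarrow> (real ^ 'n) set"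
    and p z :: "real \<Rightarrow> real ^ 'n"
    and a b \<kappa> :: "real \<Rightarrow> real"
  assumes "closed (graph F)"
    and "\<forall>t\<in>{0..1}. z t \<in> solution_set f F p t"
    and "\<exists>U :: (real \<times> (real ^ 'n)) set. open U \<and>
           {(t, v). t \<in> {0..1} \<and> 0 \<in> G_map f F p t v} \<inter> U = gph01 z"
    and "continuous_on {0..1} p"
    and "\<forall>t\<in>{0..1}. strongly_metrically_regular (G_map f F p t) (z t) 0 (a t) (b t) (\<kappa> t)"
  shows "continuous_on {0..1} z"
proof -
  obtain U :: "(real \<times> (real ^ 'n)) set" where "open U"
    and U: "{(t, v). t \<in> {0..1} \<and> 0 \<in> G_map f F p t v} \<inter> U = gph01 z"
    using assms(3) by blast
  show ?thesis
    unfolding continuous_on_def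
  proof
    fix t :: real
    assume t: "t \<in> {0..1}"
    have reg: "strongly_metrically_regular (G_map f F p t) (z t) 0 (a t) (b t) (\<kappa> t)"
      using assms(5) t by blast
    then have "b t > 0"
      by (simp add: strongly_metrically_regular_def)
    have p: "(p \<longlongrightarrow> p t) (at t within {0..1})"
      using assms(4) t by (simp add: continuous_on_def)
    then have near: "\<forall>\<^sub>F s in at t within {0..1}. dist (p s) (p t) < b t"
      using \<open>b t > 0\<close> by (rule tendstoD)
    \<comment> \<open>One solution is selected for each time \<open>s\<close>, so that limits in
      \<open>s\<close> can be taken. The choice is arbitrary where \<open>p s\<close> is too far
      from \<open>p t\<close>; by \<open>near\<close> this does not occur close to
      \<open>t\<close>.\<close>
    define x where "x s = (SOME x. 0 \<in> G_map f F p s x \<and> dist x (z t) \<le> \<kappa> t * dist (p s) (p t))" for s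
    have x: "0 \<in> G_map f F p s (x s) \<and> dist (x s) (z t) \<le> \<kappa> t * dist (p s) (p t)"
      if "dist (p s) (p t) < b t" for s
      unfolding x_def
    proof (rule someI_ex)
      have "p s - p t \<in> cball 0 (b t)"
        using that by (simp add: mem_cball dist_norm norm_minus_commute)
      then obtain v where "p s - p t \<in> G_map f F p t v" "dist v (z t) \<le> \<kappa> t * dist (p s - p t) 0"
        by (rule strongly_metrically_regular_solution[OF reg])
      then show "\<exists>v. 0 \<in> G_map f F p s v \<and> dist v (z t) \<le> \<kappa> t * dist (p s) (p t)"
        using G_map_time_shift[of f F p s v t] by (auto simp: dist_norm)
    qed
    have "((\<lambda>s. \<kappa> t * dist (p s) (p t)) \<longlongrightarrow> \<kappa> t * dist (p t) (p t)) (at t within {0..1})"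
      by (intro tendsto_intros p)
    then have bound: "((\<lambda>s. \<kappa> t * dist (p s) (p t)) \<longlongrightarrow> 0) (at t within {0..1})"
      by simp
    have "((\<lambda>s. dist (x s) (z t)) \<longlongrightarrow> 0) (at t within {0..1})"
      by (rule tendsto_sandwich[OF _ _ tendsto_const bound]) (use near x in \<open>auto elim: eventually_mono\<close>)
    then have lim: "(x \<longlongrightarrow> z t) (at t within {0..1})"
      by (rule tendsto_dist_iff[THEN iffD2])
    then have "((\<lambda>s. (s, x s)) \<longlongrightarrow> (t, z t)) (at t within {0..1})"
      by (intro tendsto_intros)
    \<comment> \<open>The isolating set contains the whole graph of \<open>z\<close>, hence is an
      open neighbourhood of \<open>(t, z t)\<close> and eventually captures
      \<open>(s, x s)\<close>.\<close>
    moreover have "(t, z t) \<in> U"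
      using U t by (auto simp: gph01_def)
    ultimately have "\<forall>\<^sub>F s in at t within {0..1}. (s, x s) \<in> U"
      using \<open>open U\<close> by (metis topological_tendstoD)
    \<comment> \<open>The isolation property concerns only times in the unit interval.\<close>
    moreover have "\<forall>\<^sub>F s in at t within {0..1}. s \<in> {0..1}"
      by (simp add: eventually_at_filter)
    ultimately have "\<forall>\<^sub>F s in at t within {0..1}. x s = z s"
      using near
    proof eventually_elim
      case (elim s)
      \<comment> \<open>The pair lies both in the solution graph and in \<open>U\<close>, whose
        intersection is \<open>gph01 z\<close>; this forces \<open>x s = z s\<close>, and
        \<open>z\<close> inherits the limit of \<open>x\<close>.\<close>
      then have "(s, x s) \<in> gph01 z"
        using U x[of s] by auto
      then show ?case
        by (auto simp: gph01_def)
    qed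
    then show "(z \<longlongrightarrow> z t) (at t within {0..1})"
      using lim tendsto_cong by blast
  qed
qed

end
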